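(* Let $k\geq 2$ be an even integer, and let $G$ be a connected graph with minimum degree $\delta\geq k+1$ and order $$n\geq\max\left\{\frac{(\delta^{2}+(2-k)\delta-2k-1)^{2}}{6(\delta-k)}+\delta+k+1,\ \delta^{2}+4\delta-k^{2}+6\right\}.$$ If $$e(G)\geq e\bigl(K_{\delta}\vee(K_{n-(\delta-k+1)\delta-1}\cup((\delta-k)\delta+1)K_1)\bigr),$$ then $G$ has the $k$-strong parity property unless $G=K_{\delta}\vee(K_{n-(\delta-k+1)\delta-1}\cup((\delta-k)\delta+1)K_1)$ (equality of graphs being understood up to isomorphism).
   Context: All graphs are finite, undirected and simple. For a graph $G$, $V(G)$ is its vertex set, its order is $n=|V(G)|$, its size $e(G)$ is its number of edges, $d_G(v)$ is the degree of the vertex $v$ in $G$, and $\delta=\delta(G)$ is the minimum degree of $G$. $K_m$ is the complete graph on $m$ vertices. $G_1\cup G_2$ denotes the union of two vertex-disjoint graphs, $mK_1$ denotes the disjoint union of $m$ copies of $K_1$ (i.e. $m$ isolated vertices), and the join $G_1\vee G_2$ of two vertex-disjoint graphs is obtained from $G_1\cup G_2$ by adding all edges joining a vertex of $G_1$ to a vertex of $G_2$. For an even integer $k\geq 2$, a graph $G$ has the $k$-strong parity property if for every $X\subseteq V(G)$ with $|X|$ even, $G$ contains a spanning subgraph $F$ (a subgraph with $V(F)=V(G)$) such that $d_F(u)\equiv 1 \pmod 2$ for each $u\in X$ and $d_F(v)\in\{k,k+2,k+4,\ldots\}$ for each $v\in V(G)\setminus X$. *)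

theory Defs
  imports Complex_Main
begin

text \<open>Undirected simple graphs are given by a vertex set and a set of two-element subsets of it.\<close>

record 'a graph =
  verts :: "'a set"
  edges :: "'a set set"

definition simple_graph :: "'a graph \<Rightarrow> bool" where
  "simple_graph G \<longleftrightarrow> finite (verts G) \<and> (\<forall>e\<in>edges G. e \<subseteq> verts G \<and> card e = 2)"

definition graph_order :: "'a graph \<Rightarrow> nat" where
  "graph_order G = card (verts G)"

definition graph_size :: "'a graph \<Rightarrow> nat" where
  "graph_size G = card (edges G)"

definition degree :: "'a graph \<Rightarrow> 'a \<Rightarrow> nat" where
  "degree G v = card {e \<in> edges G. v \<in> e}"

definition min_degree :: "'a graph \<Rightarrow> nat" where
  "min_degree G = Min (degree G ` verts G)"

definition connected_graph :: "'a graph \<Rightarrow> bool" where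
  "connected_graph G \<longleftrightarrow>
     verts G \<noteq> {} \<and> (\<forall>u\<in>verts G. \<forall>v\<in>verts G. (u, v) \<in> {(x, y). {x, y} \<in> edges G}\<^sup>*)"

definition graph_iso :: "'a graph \<Rightarrow> 'b graph \<Rightarrow> bool" where
  "graph_iso G H \<longleftrightarrow>
     (\<exists>f. bij_betw f (verts G) (verts H) \<and>
          (\<forall>u\<in>verts G. \<forall>v\<in>verts G. {u, v} \<in> edges G \<longleftrightarrow> {f u, f v} \<in> edges H))"

definition spanning_subgraph :: "'a graph \<Rightarrow> 'a graph \<Rightarrow> bool" where
  "spanning_subgraph F G \<longleftrightarrow> simple_graph F \<and> verts F = verts G \<and> edges F \<subseteq> edges G"

definition complete_graph :: "nat \<Rightarrow> nat graph" where
  "complete_graph m = \<lparr>verts = {..<m}, edges = {e. e \<subseteq> {..<m} \<and> card e = 2}\<rparr>"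

text \<open>The graph \<open>mK\<^sub>1\<close>.\<close>

definition edgeless_graph :: "nat \<Rightarrow> nat graph" where
  "edgeless_graph m = \<lparr>verts = {..<m}, edges = {}\<rparr>"

text \<open>Union and join make their arguments vertex-disjoint by passing to the sum type.\<close>

definition graph_union :: "'a graph \<Rightarrow> 'b graph \<Rightarrow> ('a + 'b) graph" where
  "graph_union G H =
     \<lparr>verts = verts G <+> verts H,
      edges = (\<lambda>e. Inl ` e) ` edges G \<union> (\<lambda>e. Inr ` e) ` edges H\<rparr>"

definition graph_join :: "'a graph \<Rightarrow> 'b graph \<Rightarrow> ('a + 'b) graph" where
  "graph_join G H =
     \<lparr>verts = verts G <+> verts H,
      edges = edges (graph_union G H) \<union> {{Inl u, Inr v} | u v. u \<in> verts G \<and> v \<in> verts H}\<rparr>"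

text \<open>The graph \<open>K\<^sub>d \<or> (K\<^bsub>n - (d - k + 1) d - 1\<^esub> \<union> ((d - k) d + 1) K\<^sub>1)\<close>. The subtractions are
  those of \<^typ>\<open>nat\<close>; they are exact if \<open>k \<le> d\<close> and \<open>(d - k + 1) d + 1 \<le> n\<close>.\<close>

definition extremal_graph :: "nat \<Rightarrow> nat \<Rightarrow> nat \<Rightarrow> (nat + (nat + nat)) graph" where
  "extremal_graph k d n =
     graph_join (complete_graph d)
       (graph_union (complete_graph (n - (d - k + 1) * d - 1))
                    (edgeless_graph ((d - k) * d + 1)))"

text \<open>Intended for even \<open>k \<ge> 2\<close>.\<close>

definition k_strong_parity :: "nat \<Rightarrow> 'a graph \<Rightarrow> bool" where
  "k_strong_parity k G \<longleftrightarrow>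
     (\<forall>X \<subseteq> verts G. even (card X) \<longrightarrow>
        (\<exists>F. spanning_subgraph F G \<and>
             (\<forall>u\<in>X. odd (degree F u)) \<and>
             (\<forall>v\<in>verts G - X. degree F v \<in> {k + 2 * i | i. True})))"

end

theory Submission
  imports Defs
begin

text \<open>Deleting from \<open>G\<close> a subgraph \<open>H\<close> with \<open>d\<^sub>H(v) \<le> b(v)\<close> and \<open>d\<^sub>H(v) \<equiv> b(v)\<close> modulo \<open>2\<close>, where
  \<open>b = d\<^sub>G - 1\<close> on \<open>X\<close> and \<open>b = d\<^sub>G - k\<close> elsewhere, leaves the required factor \<open>F\<close>. By Tutte's theorem,
  applied to the blow-up of every \<open>v\<close> to \<open>b(v)\<close> copies, such an \<open>H\<close> exists if for every \<open>T\<close> the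
  graph \<open>G - T\<close> has at most \<open>\<Sum>\<^bsub>v\<in>T\<^esub> (d\<^sub>G(v) - k) + 1\<close> components. A set \<open>T \<noteq> \<emptyset>\<close> violating this has
  small degree sum, leaves more than \<open>(\<delta> - k) |T| + 1\<close> components, and each of these has at least
  \<open>\<delta> + 1 - |T|\<close> vertices; by convexity \<open>G\<close> then has fewer edges than the extremal graph.\<close>

section \<open>Tutte's theorem\<close>

text \<open>The involution \<open>f\<close> swaps the ends of each matching edge. As a function, a
  perfect matching can be patched by updates and iterated along alternating paths.\<close>

definition matchable :: "('a \<Rightarrow> 'a \<Rightarrow> bool) \<Rightarrow> 'a set \<Rightarrow> bool" where
  "matchable E A \<longleftrightarrow> (\<exists>f. \<forall>x\<in>A. f x \<in> A \<and> f x \<noteq> x \<and> f (f x) = x \<and> E x (f x))"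

text \<open>Components are represented by labellings that are constant along edges: the classes of such
  a labelling are unions of components.\<close>

definition odd_labels :: "('a \<Rightarrow> 'b) \<Rightarrow> 'a set \<Rightarrow> 'b set" where
  "odd_labels \<kappa> A = {l. odd (card {x\<in>A. \<kappa> x = l})}"

lemma odd_labels_subset: "odd_labels \<kappa> A \<subseteq> \<kappa> ` A"
proof
  fix l assume "l \<in> odd_labels \<kappa> A"
  then have "{x\<in>A. \<kappa> x = l} \<noteq> {}"
    unfolding odd_labels_def by (metis (no_types, lifting) card.empty even_zero mem_Collect_eq)
  then show "l \<in> \<kappa> ` A" by blast
qed

text \<open>The label classes partition \<open>A\<close>, and modulo 2 only the odd ones
  count.\<close>

lemma even_card_odd_labels:
  assumes "finite A"
  shows "even (card (odd_labels \<kappa> A)) \<longleftrightarrow> even (card A)"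
proof -
  have "card A = (\<Sum>l\<in>\<kappa> ` A. card {x\<in>A. \<kappa> x = l})"
    using sum.image_gen[OF assms, of "\<lambda>_. 1::nat" \<kappa>] by simp
  moreover have "odd_labels \<kappa> A = {l \<in> \<kappa> ` A. odd (card {x\<in>A. \<kappa> x = l})}"
    using odd_labels_subset[of \<kappa> A] by (auto simp: odd_labels_def)
  ultimately show ?thesis
    using even_sum_iff[of "\<kappa> ` A" "\<lambda>l. card {x\<in>A. \<kappa> x = l}"] assms by simp
qed

section \<open>Cliques together with vertices adjacent to everything\<close>

lemma matchable_insert2:
  assumes "matchable E A" "x \<notin> A" "y \<notin> A" "x \<noteq> y" "E x y" "E y x"
  shows "matchable E (insert x (insert y A))"
proof -
  obtain f where f: "\<forall>z\<in>A. f z \<in> A \<and> f z \<noteq> z \<and> f (f z) = z \<and> E z (f z)"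
    using assms(1) unfolding matchable_def by blast
  have ne: "f z \<noteq> x" "f z \<noteq> y" "z \<noteq> x" "z \<noteq> y" if "z \<in> A" for z
    using f that assms by blast+
  show ?thesis
    unfolding matchable_def
    by (rule exI[of _ "f(x := y, y := x)"]) (use f ne assms in auto)
qed

lemma matchable_clique:
  assumes "finite A" "even (card A)" "\<And>x y. x \<in> A \<Longrightarrow> y \<in> A \<Longrightarrow> x \<noteq> y \<Longrightarrow> E x y"
  shows "matchable E A"
  using assms
proof (induction "card A" arbitrary: A rule: less_induct)
  case less
  show ?case
  proof (cases "A = {}")
    case True
    then show ?thesis by (simp add: matchable_def)
  next
    case False
    then obtain x where x: "x \<in> A" by blast
    have "card (A - {x}) \<noteq> 0"
      using less.prems(1,2) x by (metis One_nat_def Suc_pred card_Diff_singleton card_gt_0_iff empty_iff odd_one)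
    then obtain y where y: "y \<in> A" "y \<noteq> x"
      by (metis Diff_iff card.empty ex_in_conv insertCI)
    let ?B = "A - {x, y}"
    have A: "A = insert x (insert y ?B)" using x y by blast
    have cA: "card A = card ?B + 2"
      using less.prems(1) x y by (subst A) simp
    have "matchable E ?B"
      using less.hyps[of ?B] cA less.prems by auto
    then have "matchable E (insert x (insert y ?B))"
      by (rule matchable_insert2) (use x y less.prems(3) in auto)
    then show ?thesis using A by simp
  qed
qed

text \<open>The label classes of \<open>A\<close> are cliques, and \<open>B\<close> is joined to
  everything. Pairing off vertices with equal labels leaves one vertex of each odd class; these are
  matched into \<open>B\<close>, and what remains of \<open>B\<close> is a clique of even
  order.\<close>

lemma matchable_cliques:
  assumes "finite A" "finite B" "A \<inter> B = {}" "even (card A + card B)"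
    and "\<And>x y. x \<in> A \<Longrightarrow> y \<in> A \<Longrightarrow> x \<noteq> y \<Longrightarrow> \<kappa> x = \<kappa> y \<Longrightarrow> E x y"
    and "\<And>x y. x \<in> B \<Longrightarrow> y \<in> A \<union> B \<Longrightarrow> x \<noteq> y \<Longrightarrow> E x y \<and> E y x"
    and "card (odd_labels \<kappa> A) \<le> card B"
  shows "matchable E (A \<union> B)"
  using assms
proof (induction "card A" arbitrary: A B rule: less_induct)
  case less
  consider "A = {}" | (pair) x y where "x \<in> A" "y \<in> A" "x \<noteq> y" "\<kappa> x = \<kappa> y"
    | (inj) x where "x \<in> A" "inj_on \<kappa> A"
    by (metis inj_onI ex_in_conv)
  then show ?case
  proof cases
    case 1
    then show ?thesis using less.prems by (auto intro!: matchable_clique)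
  next
    case pair
    let ?A = "A - {x, y}"
    have A: "A = insert x (insert y ?A)" using pair by blast
    have cA: "card A = card ?A + 2"
      using less.prems(1) pair by (subst A) simp
    \<comment> \<open>Both vertices lie in the same class, so removing them changes no
      parity.\<close>
    have parity: "odd (card {z\<in>A. \<kappa> z = l}) \<longleftrightarrow> odd (card {z\<in>?A. \<kappa> z = l})" for l
    proof (cases "l = \<kappa> x")
      case True
      then have "{z\<in>A. \<kappa> z = l} = insert x (insert y {z\<in>?A. \<kappa> z = l})"
        using pair by auto
      then show ?thesis using less.prems(1) pair(3) by simp
    next
      case False
      then have "{z\<in>A. \<kappa> z = l} = {z\<in>?A. \<kappa> z = l}"
        using pair by auto
      then show ?thesis by simp
    qed
    then have "odd_labels \<kappa> ?A = odd_labels \<kappa> A"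
      by (simp add: odd_labels_def)
    then have "matchable E (?A \<union> B)"
      using less.prems cA by (intro less.hyps) auto
    then have "matchable E (insert x (insert y (?A \<union> B)))"
      by (rule matchable_insert2) (use pair less.prems in auto)
    moreover have "insert x (insert y (?A \<union> B)) = A \<union> B" using pair by blast
    ultimately show ?thesis by simp
  next
    case inj
    \<comment> \<open>With distinct labels every class is a single vertex, hence odd, so the
      hypothesis on \<open>B\<close> becomes \<open>card A \<le> card B\<close>.\<close>
    have labels: "odd_labels \<kappa> C = \<kappa> ` C" if "C \<subseteq> A" for C
    proof -
      have "{z\<in>C. \<kappa> z = \<kappa> w} = {w}" if "w \<in> C" for w
        using that \<open>C \<subseteq> A\<close> inj(2) by (auto dest: inj_onD)
      then have "\<kappa> ` C \<subseteq> odd_labels \<kappa> C"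
        by (auto simp: odd_labels_def)
      then show ?thesis using odd_labels_subset[of \<kappa> C] by (rule subset_antisym[rotated])
    qed
    have card_labels: "card (odd_labels \<kappa> C) = card C" if "C \<subseteq> A" for C
      using labels[OF that] card_image[OF inj_on_subset[OF inj(2) that]] by simp
    have "card A \<le> card B" using card_labels[of A] less.prems(7) by simp
    moreover have "0 < card A" using inj(1) less.prems(1) by (auto simp: card_gt_0_iff)
    ultimately obtain y where y: "y \<in> B"
      by (metis card.empty ex_in_conv less_le_not_le)
    let ?A = "A - {x}" and ?B = "B - {y}"
    have c: "card A = Suc (card ?A)" "card B = Suc (card ?B)"
      using inj(1) y less.prems(1,2) card_Suc_Diff1 by fastforce+
    have "matchable E (?A \<union> ?B)"
      using less.prems c \<open>card A \<le> card B\<close> card_labels[of ?A]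
      by (intro less.hyps) auto
    moreover have "x \<noteq> y" using inj(1) y less.prems(3) by blast
    moreover have "E x y" "E y x"
      using less.prems(6)[of y x] inj(1) y \<open>x \<noteq> y\<close> by auto
    ultimately have "matchable E (insert x (insert y (?A \<union> ?B)))"
      using inj(1) y less.prems(3) by (intro matchable_insert2) auto
    moreover have "insert x (insert y (?A \<union> ?B)) = A \<union> B" using inj(1) y by blast
    ultimately show ?thesis by simp
  qed
qed

text \<open>The exchange step of Lovasz's proof. Here \<open>f\<close> and \<open>g\<close> are perfect matchings that use,
  besides edges of \<open>E\<close>, the non-edges \<open>ac\<close> and \<open>bd\<close> respectively. Walk along the alternating path
  starting with the \<open>f\<close>-edge at \<open>d\<close>. If it meets \<open>a\<close> or \<open>c\<close>, close it up there with the edge to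
  \<open>b\<close>; otherwise its cycle separates the two non-edges.\<close>

lemma alternating_switch:
  fixes f g :: "'a \<Rightarrow> 'a"
  assumes "finite V"
    and fV: "\<And>x. x \<in> V \<Longrightarrow> f x \<in> V" and fne: "\<And>x. x \<in> V \<Longrightarrow> f x \<noteq> x"
    and ff: "\<And>x. x \<in> V \<Longrightarrow> f (f x) = x"
    and fE: "\<And>x. x \<in> V \<Longrightarrow> x \<noteq> a \<Longrightarrow> x \<noteq> c \<Longrightarrow> E x (f x)"
    and gV: "\<And>x. x \<in> V \<Longrightarrow> g x \<in> V" and gne: "\<And>x. x \<in> V \<Longrightarrow> g x \<noteq> x"
    and gg: "\<And>x. x \<in> V \<Longrightarrow> g (g x) = x"
    and gE: "\<And>x. x \<in> V \<Longrightarrow> x \<noteq> b \<Longrightarrow> x \<noteq> d \<Longrightarrow> E x (g x)"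
    and aV: "a \<in> V" and bV: "b \<in> V" and fa: "f a = c" and gb: "g b = d"
    and Eab: "E a b" "E b a" and Ebc: "E b c" "E c b" and ne: "b \<noteq> a" "b \<noteq> c"
  shows "matchable E V"
proof -
  \<comment> \<open>The \<open>s i\<close> are the even positions on the path from \<open>d\<close>
    that takes \<open>f\<close>- and \<open>g\<close>-edges in turn; the odd positions are
    \<open>f (s i)\<close>.\<close>
  define s where "s i = ((g \<circ> f) ^^ i) d" for i
  have s0: "s 0 = d" and sSuc: "s (Suc i) = g (f (s i))" for i by (simp_all add: s_def)
  have dV: "d \<in> V" using gb gV bV by blast
  have cV: "c \<in> V" using fa fV aV by blast
  have gd: "g d = b" using gb gg bV by blast
  have fc: "f c = a" using fa ff aV by blast
  have sV: "s i \<in> V" for i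
    by (induction i) (use s0 sSuc dV fV gV in auto)
  \<comment> \<open>Cancelling a step at both ends replaces \<open>x\<close> by
    \<open>g (f x)\<close> and \<open>i\<close> by \<open>i - 2\<close>, down to a fixed point of
    \<open>f\<close> or \<open>g\<close>. For \<open>x = d\<close> this shows that \<open>b\<close>
    is no \<open>s i\<close>.\<close>
  have odd_walk: "((g \<circ> f) ^^ i) x \<noteq> g x" if "x \<in> V" for i x
    using that
  proof (induction i arbitrary: x rule: less_induct)
    case (less i)
    have pV: "((g \<circ> f) ^^ m) x \<in> V" for m
      by (induction m) (use less.prems fV gV in auto)
    consider "i = 0" | "i = 1" | m where "i = Suc (Suc m)"
      by (metis One_nat_def not0_implies_Suc)
    then show ?case
    proof cases
      case 1
      then show ?thesis using gne[OF less.prems] by simp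
    next
      case 2
      show ?thesis
      proof
        assume "((g \<circ> f) ^^ i) x = g x"
        then have "g (f x) = g x" using 2 by simp
        then have "f x = x" using gg fV less.prems by metis
        then show False using fne less.prems by blast
      qed
    next
      case 3
      show ?thesis
      proof
        assume "((g \<circ> f) ^^ i) x = g x"
        then have "g (f (((g \<circ> f) ^^ Suc m) x)) = g x" using 3 by simp
        then have "f (((g \<circ> f) ^^ Suc m) x) = x" using gg fV less.prems pV by metis
        then have "((g \<circ> f) ^^ Suc m) x = f x" using ff pV by metis
        moreover have "((g \<circ> f) ^^ Suc m) x = ((g \<circ> f) ^^ m) (g (f x))"
          by (simp add: funpow_swap1)
        moreover have "f x = g (g (f x))" using gg fV less.prems by simp
        ultimately have "((g \<circ> f) ^^ m) (g (f x)) = g (g (f x))" by simp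
        moreover have "g (f x) \<in> V" using gV fV less.prems by blast
        ultimately show False using less.IH[of m "g (f x)"] 3 by simp
      qed
    qed
  qed
  \<comment> \<open>\<open>f\<close> and \<open>g\<close> are injective on \<open>V\<close>, so a
    repetition can be pulled back to the start \<open>d\<close>.\<close>
  have shift: "s i = s (i + p) \<Longrightarrow> s 0 = s p" for i p
  proof (induction i)
    case (Suc i)
    then have "g (f (s i)) = g (f (s (i + p)))" by (simp add: sSuc)
    then have "s i = s (i + p)" using gg ff fV sV by metis
    then show ?case using Suc.IH by blast
  qed simp
  have "\<not> inj s"
    using \<open>finite V\<close> sV finite_imageD[of s UNIV] finite_subset[of "range s" V] by auto
  then obtain i j where "s i = s j" "i < j"
    by (metis injI nat_neq_iff)
  then have "s (j - i) = d" "0 < j - i"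
    using shift[of i "j - i"] s0 by auto
  then have ex: "\<exists>N. 0 < N \<and> s N = d" by blast
  define N where "N = (LEAST N. 0 < N \<and> s N = d)"
  have N: "0 < N" "s N = d" using LeastI_ex[OF ex] unfolding N_def by auto
  have Nleast: "s i \<noteq> d" if "0 < i" "i < N" for i
    using that not_less_Least unfolding N_def by blast
  have period: "s (i + N) = s i" for i
    by (induction i) (use N s0 sSuc in auto)
  show ?thesis
  \<comment> \<open>Even positions suffice: \<open>f\<close> swaps \<open>a\<close> and
    \<open>c\<close>, so one of them is met at an odd position only right after the other.\<close>
  proof (cases "\<exists>i. s i \<in> {a, c}")
    case True
    define j where "j = (LEAST i. s i \<in> {a, c})"
    have j: "s j \<in> {a, c}" using LeastI_ex[OF True] unfolding j_def by auto
    have jleast: "s i \<notin> {a, c}" if "i < j" for i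
      using that not_less_Least unfolding j_def by blast
    have jN: "j < N"
    proof (rule ccontr)
      assume "\<not> j < N"
      then have "s (j - N) = s j" using period[of "j - N"] by simp
      then show False using jleast[of "j - N"] j N(1) \<open>\<not> j < N\<close> by simp
    qed
    \<comment> \<open>\<open>a'\<close> is whichever of \<open>a\<close> and \<open>c\<close> the
      path reaches first, and \<open>c'\<close> is the other.\<close>
    obtain a' c' where ac: "{a', c'} = {a, c}" "s j = a'" "f a' = c'" "f c' = a'"
        "E a' b" "E b a'" "b \<noteq> a'" "a' \<in> V"
    proof (cases "s j = a")
      case True
      then show thesis using that[of a c] fa fc Eab ne aV by simp
    next
      case False
      then show thesis using that[of c a] fa fc Ebc ne cV j by auto
    qed
    \<comment> \<open>\<open>P\<close> is the path from \<open>d\<close> to \<open>a'\<close>. Only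
      at \<open>a'\<close> does \<open>f\<close> leave it, only at \<open>d\<close> does
      \<open>g\<close>, and neither \<open>b\<close> nor \<open>c'\<close> is on it.\<close>
    define P where "P = s ` {..j} \<union> (\<lambda>i. f (s i)) ` {..<j}"
    have aP: "a' \<in> P" using ac(2) by (auto simp: P_def)
    have dP: "d \<in> P" using s0 by (force simp: P_def)
    have bP: "b \<notin> P"
    proof
      assume "b \<in> P"
      then consider i where "b = s i" | i where "b = f (s i)" "i < j"
        by (auto simp: P_def)
      then show False
      proof cases
        case 1
        then show False using odd_walk[OF dV, of i] gd by (simp add: s_def)
      next
        case 2
        then have "s (Suc i) = d" using gb sSuc by metis
        then show False using Nleast[of "Suc i"] 2(2) jN by simp
      qed
    qed
    have cP: "c' \<notin> P"
    proof
      assume "c' \<in> P"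
      then consider i where "c' = s i" "i \<le> j" | i where "c' = f (s i)" "i < j"
        by (auto simp: P_def)
      then show False
      proof cases
        case 1
        then have "i = j" using jleast[of i] ac(1) by (metis insertCI le_neq_implies_less)
        then show False using 1 ac(2,3,8) fne by metis
      next
        case 2
        then have "s i = a'" using ac(4) ff sV by metis
        then show False using 2 jleast[of i] ac(1) by (metis insertCI)
      qed
    qed
    have fP: "f x \<in> P" if "x \<in> P" "x \<noteq> a'" for x
    proof -
      consider i where "x = s i" "i \<le> j" | i where "x = f (s i)" "i < j"
        using \<open>x \<in> P\<close> by (auto simp: P_def)
      then show ?thesis
      proof cases
        case 1
        then have "i < j" using that ac(2) by (cases "i = j") auto
        then show ?thesis using 1 by (auto simp: P_def)
      next
        case 2
        then have "f x = s i" using ff sV by simp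
        then show ?thesis using 2 by (auto simp: P_def)
      qed
    qed
    have gP: "g x \<in> P" if "x \<in> P" "x \<noteq> d" for x
    proof -
      consider i where "x = s i" "i \<le> j" | i where "x = f (s i)" "i < j"
        using \<open>x \<in> P\<close> by (auto simp: P_def)
      then show ?thesis
      proof cases
        case 1
        then obtain m where "i = Suc m" using \<open>x \<noteq> d\<close> s0 by (metis not0_implies_Suc)
        then have "g x = f (s m)" "m < j" using 1 sSuc gg fV sV by auto
        then show ?thesis by (auto simp: P_def)
      next
        case 2
        then have "g x = s (Suc i)" using sSuc by simp
        then show ?thesis using 2 by (auto simp: P_def)
      qed
    qed
    \<comment> \<open>\<open>f\<close> inside \<open>P\<close> and \<open>g\<close> outside, except
      that \<open>a'\<close> and \<open>b\<close> are matched to each other: \<open>a'\<close> loses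
      its \<open>f\<close>-partner \<open>c'\<close> outside \<open>P\<close>, and \<open>b\<close>
      its \<open>g\<close>-partner \<open>d\<close> in \<open>P\<close>.\<close>
    define h where "h x = (if x = a' then b else if x = b then a'
      else if x \<in> P then f x else g x)" for x
    have "h x \<in> V \<and> h x \<noteq> x \<and> h (h x) = x \<and> E x (h x)" if x: "x \<in> V" for x
    proof -
      consider "x = a'" | "x = b" | (P) "x \<in> P" "x \<noteq> a'" "x \<noteq> b" | (nP) "x \<notin> P" "x \<noteq> a'" "x \<noteq> b"
        by blast
      then show ?thesis
      proof cases
        case P
        have "f x \<noteq> a'" using P cP ac(3) ff x by metis
        moreover have "f x \<in> P" "f x \<noteq> b" using fP[OF P(1,2)] bP by auto
        moreover have "x \<noteq> a" "x \<noteq> c" using P cP ac(1) by auto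
        ultimately show ?thesis using P fV[OF x] fne[OF x] ff[OF x] fE[OF x] by (simp add: h_def)
      next
        case nP
        have "x \<noteq> d" using nP dP by blast
        then have "g x \<noteq> b" using gb gg x by metis
        have "g x \<noteq> d" using nP gd gg x by metis
        then have "g x \<notin> P" using gP[of "g x"] gg[OF x] nP by auto
        moreover have "g x \<noteq> a'" using \<open>g x \<notin> P\<close> aP by blast
        ultimately show ?thesis
          using nP \<open>g x \<noteq> b\<close> \<open>x \<noteq> d\<close> gV[OF x] gne[OF x] gg[OF x] gE[OF x] by (simp add: h_def)
      qed (use ac(5-8) bV in \<open>auto simp: h_def\<close>)
    qed
    then show ?thesis unfolding matchable_def by blast
  next
    case False
    \<comment> \<open>\<open>O'\<close> is the whole alternating cycle through \<open>d\<close>. It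
      closes with the \<open>g\<close>-edge from \<open>b\<close> to \<open>d\<close> and avoids
      \<open>a\<close> and \<open>c\<close>, so \<open>f\<close> can be used on it and
      \<open>g\<close> off it.\<close>
    define O' where "O' = range s \<union> range (\<lambda>i. f (s i))"
    have dO: "d \<in> O'" using s0 by (force simp: O'_def)
    have bO: "b \<in> O'"
    proof -
      obtain m where "N = Suc m" using N(1) by (cases N) auto
      then have "g (f (s m)) = d" using N(2) sSuc by simp
      then have "b = f (s m)" using gd gg fV sV by metis
      then show ?thesis by (auto simp: O'_def)
    qed
    have "f (s i) \<noteq> a" "f (s i) \<noteq> c" for i
      using False fa fc ff[OF sV[of i]] by (metis insertCI)+
    then have acO: "a \<notin> O'" "c \<notin> O'"
      using False unfolding O'_def by blast+
    have fO: "f x \<in> O'" if "x \<in> O'" for x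
      using that ff sV by (auto simp: O'_def)
    have gO: "g x \<in> O'" if "x \<in> O'" for x
    proof -
      consider i where "x = s i" | i where "x = f (s i)"
        using \<open>x \<in> O'\<close> unfolding O'_def by blast
      then show ?thesis
      proof cases
        case 1
        show ?thesis
        proof (cases i)
          case 0
          then show ?thesis using 1 s0 gd bO by simp
        next
          case (Suc m)
          then have "g x = f (s m)" using 1 sSuc gg fV sV by simp
          then show ?thesis by (auto simp: O'_def)
        qed
      next
        case 2
        then have "g x = s (Suc i)" using sSuc by simp
        then show ?thesis by (auto simp: O'_def)
      qed
    qed
    define h where "h x = (if x \<in> O' then f x else g x)" for x
    have "h x \<in> V \<and> h x \<noteq> x \<and> h (h x) = x \<and> E x (h x)" if x: "x \<in> V" for x
    proof (cases "x \<in> O'")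
      case True
      moreover have "x \<noteq> a" "x \<noteq> c" using True acO by auto
      ultimately show ?thesis
        using fO[of x] fV[OF x] fne[OF x] ff[OF x] fE[OF x] by (simp add: h_def)
    next
      case False
      moreover have "x \<noteq> b" "x \<noteq> d" using False bO dO by auto
      moreover have "g x \<notin> O'" using False gO[of "g x"] gg[OF x] by auto
      ultimately show ?thesis
        using gV[OF x] gne[OF x] gg[OF x] gE[OF x] by (simp add: h_def)
    qed
    then show ?thesis unfolding matchable_def by blast
  qed
qed

text \<open>With components as labels the hypothesis is Tutte's condition. The proof is by induction
  on the number of non-adjacent pairs: a pair added to \<open>E\<close> admits no new labellings, so
  the larger graph is matchable. Either the vertices not adjacent to all others form disjoint
  cliques, or two matchings of larger graphs are switched.\<close>

theorem tutte_matchable: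
  fixes E :: "'a \<Rightarrow> 'a \<Rightarrow> bool"
  assumes "finite V" "symp E"
    and "\<And>U (\<kappa> :: 'a \<Rightarrow> nat). U \<subseteq> V \<Longrightarrow> (\<And>x y. x \<in> V - U \<Longrightarrow> y \<in> V - U \<Longrightarrow> E x y \<Longrightarrow> \<kappa> x = \<kappa> y)
      \<Longrightarrow> card (odd_labels \<kappa> (V - U)) \<le> card U"
  shows "matchable E V"
  using assms(2,3)
proof (induction "card {(x, y) \<in> V \<times> V. \<not> E x y}" arbitrary: E rule: less_induct)
  case less
  have sym: "E x y \<Longrightarrow> E y x" for x y using less.prems(1) by (rule sympD)
  have evenV: "even (card V)"
  proof -
    \<comment> \<open>With \<open>U\<close> empty, the constant labelling has the single class
      \<open>V\<close>, which must not be odd.\<close>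
    have "card (odd_labels (\<lambda>_. 0::nat) V) = 0" using less.prems(2)[of "{}" "\<lambda>_. 0"] by simp
    then show ?thesis using even_card_odd_labels[OF \<open>finite V\<close>] by (metis even_zero)
  qed
  have extend: "\<exists>f. \<forall>z\<in>V. f z \<in> V \<and> f z \<noteq> z \<and> f (f z) = z \<and> (E z (f z) \<or> {z, f z} = {x, y})"
    if xy: "x \<in> V" "y \<in> V" "\<not> E x y" for x y
  proof -
    let ?E = "\<lambda>u v. E u v \<or> {u, v} = {x, y}"
    have "{(u, v) \<in> V \<times> V. \<not> ?E u v} \<subset> {(u, v) \<in> V \<times> V. \<not> E u v}"
      using xy by auto
    then have "card {(u, v) \<in> V \<times> V. \<not> ?E u v} < card {(u, v) \<in> V \<times> V. \<not> E u v}"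
      by (rule psubset_card_mono[OF finite_subset[of _ "V \<times> V"], rotated -1])
         (use \<open>finite V\<close> in auto)
    moreover have "symp ?E" using sym by (auto intro!: sympI simp: insert_commute)
    moreover have "card (odd_labels \<kappa> (V - U)) \<le> card U"
      if "U \<subseteq> V" "\<And>u v. u \<in> V - U \<Longrightarrow> v \<in> V - U \<Longrightarrow> ?E u v \<Longrightarrow> \<kappa> u = \<kappa> v"
      for U and \<kappa> :: "'a \<Rightarrow> nat"
      using less.prems(2)[of U \<kappa>] that by blast
    ultimately have "matchable ?E V" using less.hyps[of ?E] by blast
    then show ?thesis unfolding matchable_def .
  qed
  define U where "U = {u\<in>V. \<forall>v\<in>V. v \<noteq> u \<longrightarrow> E u v}"
  show ?case
  proof (cases "\<forall>x\<in>V - U. \<forall>y\<in>V - U. \<forall>z\<in>V - U. E x y \<longrightarrow> E y z \<longrightarrow> x = z \<or> E x z")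
    case True
    obtain \<iota> :: "'a \<Rightarrow> nat" where inj: "inj_on \<iota> V"
      using finite_imp_inj_to_nat_seg[OF \<open>finite V\<close>] by blast
    \<comment> \<open>The label is the least number in the closed neighbourhood within
      \<open>V - U\<close>. Transitivity makes these neighbourhoods equal for adjacent vertices, and
      equal labels give a common member, hence adjacency.\<close>
    define \<kappa> where "\<kappa> x = (LEAST i. \<exists>y\<in>V - U. i = \<iota> y \<and> (x = y \<or> E x y))" for x
    have \<kappa>_edge: "\<kappa> x = \<kappa> y" if "x \<in> V - U" "y \<in> V - U" "E x y" for x y
    proof -
      have "(x = z \<or> E x z) \<longleftrightarrow> (y = z \<or> E y z)" if "z \<in> V - U" for z
        using True \<open>x \<in> V - U\<close> \<open>y \<in> V - U\<close> \<open>E x y\<close> that sym by blast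
      then show ?thesis unfolding \<kappa>_def by metis
    qed
    have \<kappa>_rep: "\<exists>y\<in>V - U. \<kappa> x = \<iota> y \<and> (x = y \<or> E x y)" if "x \<in> V - U" for x
      unfolding \<kappa>_def by (rule LeastI_ex) (use that in blast)
    have \<kappa>_eq: "E x y" if xy: "x \<in> V - U" "y \<in> V - U" "x \<noteq> y" "\<kappa> x = \<kappa> y" for x y
    proof -
      obtain z where z: "z \<in> V - U" "\<kappa> x = \<iota> z" "x = z \<or> E x z"
        using \<kappa>_rep[OF xy(1)] by blast
      obtain z' where z': "z' \<in> V - U" "\<kappa> y = \<iota> z'" "y = z' \<or> E y z'"
        using \<kappa>_rep[OF xy(2)] by blast
      have "z = z'" using inj z z' xy(4) by (auto dest: inj_onD)
      then show ?thesis using True xy z z' sym by blast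
    qed
    have "U \<subseteq> V" by (auto simp: U_def)
    then have "card V = card (V - U) + card U"
      using card_Int_Diff[OF \<open>finite V\<close>, of U] \<open>U \<subseteq> V\<close> by (simp add: Int_absorb1)
    have "matchable E ((V - U) \<union> U)"
    proof (rule matchable_cliques[where \<kappa> = \<kappa>])
      show "finite (V - U)" "finite U"
        using \<open>finite V\<close> \<open>U \<subseteq> V\<close> finite_subset by auto
      show "even (card (V - U) + card U)"
        using evenV \<open>card V = card (V - U) + card U\<close> by simp
      show "E x y \<and> E y x" if "x \<in> U" "y \<in> (V - U) \<union> U" "x \<noteq> y" for x y
      proof -
        have "y \<in> V" using that(2) \<open>U \<subseteq> V\<close> by blast
        then have "E x y" using that(1,3) by (simp add: U_def)
        then show ?thesis using sym by blast
      qed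
      show "card (odd_labels \<kappa> (V - U)) \<le> card U"
        by (rule less.prems(2)[OF \<open>U \<subseteq> V\<close> \<kappa>_edge])
    qed (use \<kappa>_eq in blast)+
    moreover have "(V - U) \<union> U = V" by (auto simp: U_def)
    ultimately show ?thesis by simp
  next
    case False
    \<comment> \<open>Failing transitivity gives an induced path \<open>a\<close>, \<open>b\<close>,
      \<open>c\<close>. As \<open>b\<close> is outside \<open>U\<close>, it also misses some
      \<open>d\<close>; \<open>ac\<close> and \<open>bd\<close> are the non-edges of the
      switch.\<close>
    then obtain a b c where abc: "a \<in> V" "b \<in> V - U" "c \<in> V" "E a b" "E b c" "a \<noteq> c" "\<not> E a c"
      by blast
    then obtain d where d: "d \<in> V" "d \<noteq> b" "\<not> E b d" by (auto simp: U_def)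
    obtain f where f: "\<forall>z\<in>V. f z \<in> V \<and> f z \<noteq> z \<and> f (f z) = z \<and> (E z (f z) \<or> {z, f z} = {a, c})"
      using extend[of a c] abc by blast
    obtain g where g: "\<forall>z\<in>V. g z \<in> V \<and> g z \<noteq> z \<and> g (g z) = z \<and> (E z (g z) \<or> {z, g z} = {b, d})"
      using extend[of b d] abc d by blast
    have matchable_f: "matchable E V" if "f a \<noteq> c"
    proof -
      have "{z, f z} \<noteq> {a, c}" if "z \<in> V" for z
        using f \<open>f a \<noteq> c\<close> that abc(1) by (metis doubleton_eq_iff)
      then show ?thesis using f unfolding matchable_def by blast
    qed
    have matchable_g: "matchable E V" if "g b \<noteq> d"
    proof -
      have "{z, g z} \<noteq> {b, d}" if "z \<in> V" for z
        using g \<open>g b \<noteq> d\<close> that abc(2) by (metis DiffD1 doubleton_eq_iff)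
      then show ?thesis using g unfolding matchable_def by blast
    qed
    have "b \<noteq> a" "b \<noteq> c" using abc by metis+
    then have "matchable E V" if "f a = c" "g b = d"
      using that abc d f g sym
      by (intro alternating_switch[where f = f and g = g and a = a and b = b and c = c and d = d, OF \<open>finite V\<close>])
         (auto simp: doubleton_eq_iff)
    then show ?thesis using matchable_f matchable_g by blast
  qed
qed

section \<open>Subgraphs with bounded degrees of prescribed parity\<close>

lemma card_incident_edges:
  assumes "\<And>e. e \<in> H \<Longrightarrow> card e = 2"
  shows "card {e \<in> H. v \<in> e} = card {u. {v, u} \<in> H}"
proof -
  have "bij_betw (\<lambda>u. {v, u}) {u. {v, u} \<in> H} {e \<in> H. v \<in> e}"
    unfolding bij_betw_def
  proof
    show "inj_on (\<lambda>u. {v, u}) {u. {v, u} \<in> H}"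
      by (auto simp: inj_on_def doubleton_eq_iff)
    show "(\<lambda>u. {v, u}) ` {u. {v, u} \<in> H} = {e \<in> H. v \<in> e}"
    proof (intro equalityI subsetI)
      fix e assume "e \<in> {e \<in> H. v \<in> e}"
      then obtain u where "e = {v, u}"
        using assms[of e] by (auto simp: card_2_iff)
      with \<open>e \<in> _\<close> show "e \<in> (\<lambda>u. {v, u}) ` {u. {v, u} \<in> H}" by blast
    qed auto
  qed
  then show ?thesis by (simp add: bij_betw_same_card)
qed

lemma even_card_involution:
  assumes "finite A" "\<And>x. x \<in> A \<Longrightarrow> f x \<in> A \<and> f x \<noteq> x \<and> f (f x) = x"
  shows "even (card A)"
  using assms
proof (induction "card A" arbitrary: A rule: less_induct)
  case less
  show ?case
  proof (cases "A = {}")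
    case False
    then obtain x where x: "x \<in> A" by blast
    let ?B = "A - {x, f x}"
    have A: "A = insert x (insert (f x) ?B)" using x less.prems(2) by blast
    have "x \<noteq> f x" using x less.prems(2) by metis
    then have cA: "card A = card ?B + 2"
      using less.prems(1) by (subst A) simp
    have "f z \<in> ?B \<and> f z \<noteq> z \<and> f (f z) = z" if "z \<in> ?B" for z
      using that less.prems(2) x by (metis DiffD1 DiffD2 DiffI insert_iff singletonD)
    then have "even (card ?B)" using less.hyps[of ?B] cA less.prems(1) by simp
    then show ?thesis using cA by simp
  qed simp
qed

text \<open>Replace every vertex \<open>v\<close> by a clique on \<open>b v\<close> copies of it. A perfect matching of the
  blow-up projects to a multigraph with degrees \<open>b v\<close>, and discarding loops and keeping the edges
  of odd multiplicity preserves the parity of the degrees.\<close>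

lemma bounded_parity_subgraph:
  fixes G :: "'a graph" and b :: "'a \<Rightarrow> nat"
  assumes G: "simple_graph G" and even_b: "even (sum b (verts G))"
    and cond: "\<And>T (\<kappa> :: 'a \<Rightarrow> nat). T \<subseteq> verts G \<Longrightarrow>
      (\<And>x y. x \<in> verts G - T \<Longrightarrow> y \<in> verts G - T \<Longrightarrow> {x, y} \<in> edges G \<Longrightarrow> \<kappa> x = \<kappa> y) \<Longrightarrow>
      card (\<kappa> ` (verts G - T)) \<le> sum b T + 1"
  obtains H where "H \<subseteq> edges G"
    "\<And>v. v \<in> verts G \<Longrightarrow> card {e \<in> H. v \<in> e} \<le> b v"
    "\<And>v. v \<in> verts G \<Longrightarrow> even (card {e \<in> H. v \<in> e}) \<longleftrightarrow> even (b v)"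
proof -
  define V where "V = verts G"
  have finV: "finite V" and edge: "\<And>e. e \<in> edges G \<Longrightarrow> e \<subseteq> V \<and> card e = 2"
    using G by (auto simp: simple_graph_def V_def)
  define W where "W = Sigma V (\<lambda>v. {..<b v})"
  define E where "E p q \<longleftrightarrow> fst p = fst q \<or> {fst p, fst q} \<in> edges G" for p q :: "'a \<times> nat"
  have finW: "finite W" using finV by (simp add: W_def)
  have evenW: "even (card W)" using even_b finV by (simp add: W_def V_def)
  have "matchable E W"
  proof (rule tutte_matchable[OF finW])
    show "symp E" by (auto intro!: sympI simp: E_def insert_commute)
    fix U and \<kappa> :: "'a \<times> nat \<Rightarrow> nat"
    assume U: "U \<subseteq> W" and \<kappa>: "\<And>p q. p \<in> W - U \<Longrightarrow> q \<in> W - U \<Longrightarrow> E p q \<Longrightarrow> \<kappa> p = \<kappa> q"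
    \<comment> \<open>\<open>T\<close> also contains the vertices with \<open>b v = 0\<close>, which
      add nothing to the sum. Every other vertex keeps a copy \<open>(v, r v)\<close>, and all its
      remaining copies, being adjacent to this one, share its label.\<close>
    define T where "T = {v\<in>V. {v} \<times> {..<b v} \<subseteq> U}"
    define r where "r v = (SOME i. i < b v \<and> (v, i) \<notin> U)" for v
    have r: "(v, r v) \<in> W - U" if "v \<in> V - T" for v
    proof -
      have "\<exists>i. i < b v \<and> (v, i) \<notin> U" using that by (auto simp: T_def)
      then have "r v < b v \<and> (v, r v) \<notin> U" unfolding r_def by (rule someI_ex)
      then show ?thesis using that by (simp add: W_def)
    qed
    have "card ((\<lambda>v. \<kappa> (v, r v)) ` (V - T)) \<le> sum b T + 1"
      unfolding V_def
    proof (rule cond)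
      show "T \<subseteq> verts G" by (auto simp: T_def V_def)
      show "\<kappa> (x, r x) = \<kappa> (y, r y)"
        if "x \<in> verts G - T" "y \<in> verts G - T" "{x, y} \<in> edges G" for x y
        using that r by (intro \<kappa>) (auto simp: E_def V_def)
    qed
    moreover have "\<kappa> ` (W - U) \<subseteq> (\<lambda>v. \<kappa> (v, r v)) ` (V - T)"
    proof
      fix l assume "l \<in> \<kappa> ` (W - U)"
      then obtain v i where vi: "(v, i) \<in> W - U" "l = \<kappa> (v, i)" by auto
      then have v: "v \<in> V - T" by (auto simp: W_def T_def)
      then have "l = \<kappa> (v, r v)" using \<kappa>[OF vi(1) r[OF v]] vi(2) by (simp add: E_def)
      then show "l \<in> (\<lambda>v. \<kappa> (v, r v)) ` (V - T)" using v by blast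
    qed
    then have "card (\<kappa> ` (W - U)) \<le> card ((\<lambda>v. \<kappa> (v, r v)) ` (V - T))"
      using finV by (intro card_mono) auto
    moreover have "card (odd_labels \<kappa> (W - U)) \<le> card (\<kappa> ` (W - U))"
      using finW by (intro card_mono odd_labels_subset) auto
    moreover have "sum b T \<le> card U"
    proof -
      have "finite U" using U finW finite_subset by blast
      moreover have "Sigma T (\<lambda>v. {..<b v}) \<subseteq> U" by (auto simp: T_def)
      ultimately have "card (Sigma T (\<lambda>v. {..<b v})) \<le> card U" by (rule card_mono)
      moreover have "finite T" using finV by (simp add: T_def)
      ultimately show ?thesis by simp
    qed
    \<comment> \<open>\<open>cond\<close> allows one class more than Tutte's condition. Parity rules
      it out, since \<open>card W\<close> is even.\<close>
    ultimately have "card (odd_labels \<kappa> (W - U)) \<le> card U + 1" by linarith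
    moreover have "card W = card U + card (W - U)"
      using card_Int_Diff[OF finW, of U] U by (simp add: Int_absorb1)
    then have "even (card (odd_labels \<kappa> (W - U))) \<longleftrightarrow> even (card U)"
      using even_card_odd_labels[of "W - U" \<kappa>] finW evenW by simp
    then have "card (odd_labels \<kappa> (W - U)) \<noteq> card U + 1" by auto
    ultimately show "card (odd_labels \<kappa> (W - U)) \<le> card U" by simp
  qed
  then obtain f where f: "\<And>p. p \<in> W \<Longrightarrow> f p \<in> W \<and> f p \<noteq> p \<and> f (f p) = p \<and> E p (f p)"
    unfolding matchable_def by blast
  \<comment> \<open>\<open>card (M u v)\<close> is the multiplicity of \<open>uv\<close> in the
    projected multigraph. \<open>M v v\<close> contains both ends of each loop, so its size is
    even.\<close>
  define M where "M u v = {p\<in>W. fst p = u \<and> fst (f p) = v}" for u v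
  have finM: "finite (M u v)" for u v using finW by (simp add: M_def)
  have M_sym: "card (M u v) = card (M v u)" for u v
    using f by (intro bij_betw_same_card[of f] bij_betw_byWitness[where f' = f]) (auto simp: M_def)
  have M_loop: "even (card (M v v))" for v
    using f by (intro even_card_involution[of _ f] finM) (auto simp: M_def)
  have M_sum: "b v = card (M v v) + (\<Sum>u\<in>V - {v}. card (M v u))" if v: "v \<in> V" for v
  proof -
    have "{p\<in>W. fst p = v} = {v} \<times> {..<b v}" using v by (auto simp: W_def)
    then have "b v = (\<Sum>p | p \<in> W \<and> fst p = v. 1)" by simp
    also have "\<dots> = (\<Sum>u\<in>V. card (M v u))"
    proof -
      have "(\<lambda>p. fst (f p)) ` {p\<in>W. fst p = v} \<subseteq> V" using f by (force simp: W_def)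
      then show ?thesis
        using sum.group[of "{p\<in>W. fst p = v}" V "\<lambda>p. fst (f p)" "\<lambda>_. 1::nat"] finW finV
        by (simp add: M_def conj_assoc)
    qed
    also have "\<dots> = card (M v v) + (\<Sum>u\<in>V - {v}. card (M v u))"
      using finV v by (rule sum.remove)
    finally show ?thesis .
  qed
  define H where "H = {e \<in> edges G. \<exists>u v. e = {u, v} \<and> odd (card (M u v))}"
  have H_iff: "{v, u} \<in> H \<longleftrightarrow> {v, u} \<in> edges G \<and> odd (card (M v u))" for u v
    using M_sym by (auto simp: H_def doubleton_eq_iff)
  have degH: "card {e \<in> H. v \<in> e} = card {u \<in> V - {v}. odd (card (M v u))}" for v
  proof -
    have "card {e \<in> H. v \<in> e} = card {u. {v, u} \<in> H}"
      using edge by (intro card_incident_edges) (auto simp: H_def)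
    also have "{u. {v, u} \<in> H} = {u \<in> V - {v}. odd (card (M v u))}"
    proof (intro equalityI subsetI)
      fix u assume "u \<in> {u. {v, u} \<in> H}"
      then show "u \<in> {u \<in> V - {v}. odd (card (M v u))}"
        using H_iff[of v u] edge[of "{v, u}"] by auto
    next
      fix u assume u: "u \<in> {u \<in> V - {v}. odd (card (M v u))}"
      then have "M v u \<noteq> {}" by (metis (mono_tags, lifting) card.empty even_zero mem_Collect_eq)
      then have "{v, u} \<in> edges G" using f u by (force simp: M_def E_def)
      then show "u \<in> {u. {v, u} \<in> H}" using H_iff u by simp
    qed
    finally show ?thesis .
  qed
  show thesis
  proof (rule that)
    show "H \<subseteq> edges G" by (auto simp: H_def)
    fix v assume "v \<in> verts G"
    then have b: "b v = card (M v v) + (\<Sum>u\<in>V - {v}. card (M v u))" using M_sum V_def by blast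
    have "card {u \<in> V - {v}. odd (card (M v u))} \<le> (\<Sum>u | u \<in> V - {v} \<and> odd (card (M v u)). card (M v u))"
      unfolding card_eq_sum by (rule sum_mono) (auto simp: M_def intro!: Suc_leI odd_pos)
    also have "\<dots> \<le> (\<Sum>u\<in>V - {v}. card (M v u))"
      using finV by (intro sum_mono2) auto
    finally show "card {e \<in> H. v \<in> e} \<le> b v" using b degH by simp
    show "even (card {e \<in> H. v \<in> e}) \<longleftrightarrow> even (b v)"
      using b degH M_loop finV even_sum_iff[of "V - {v}" "\<lambda>u. card (M v u)"] by simp
  qed
qed

section \<open>From deleted subgraphs to the strong parity property\<close>

lemma handshake:
  assumes "simple_graph G"
  shows "finite (edges G)" and "(\<Sum>v\<in>verts G. degree G v) = 2 * graph_size G"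
proof -
  have G: "finite (verts G)" "\<And>e. e \<in> edges G \<Longrightarrow> e \<subseteq> verts G \<and> card e = 2"
    using assms by (auto simp: simple_graph_def)
  then show fin: "finite (edges G)"
    using finite_subset[of "edges G" "Pow (verts G)"] by auto
  have "{v\<in>verts G. v \<in> e} = e" if "e \<in> edges G" for e using G(2)[OF that] by blast
  then have "\<forall>e\<in>edges G. card {v\<in>verts G. v \<in> e} = 2" using G(2) by simp
  then show "(\<Sum>v\<in>verts G. degree G v) = 2 * graph_size G"
    using sum_multicount[OF G(1) fin] unfolding degree_def graph_size_def by blast
qed

text \<open>Upper bounds on the degrees of the deleted subgraph become lower bounds for the factor.
  The criterion uses \<open>degree G v - k\<close>, the smaller of the two possible values of
  \<open>b v\<close>, and so serves every \<open>X\<close> at once.\<close>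

lemma k_strong_parityI:
  fixes G :: "'a graph"
  assumes G: "simple_graph G" and "even k" "0 < k"
    and deg: "\<And>v. v \<in> verts G \<Longrightarrow> k \<le> degree G v"
    and cond: "\<And>T (\<kappa> :: 'a \<Rightarrow> nat). T \<subseteq> verts G \<Longrightarrow>
      (\<And>x y. x \<in> verts G - T \<Longrightarrow> y \<in> verts G - T \<Longrightarrow> {x, y} \<in> edges G \<Longrightarrow> \<kappa> x = \<kappa> y) \<Longrightarrow>
      card (\<kappa> ` (verts G - T)) \<le> (\<Sum>v\<in>T. degree G v - k) + 1"
  shows "k_strong_parity k G"
  unfolding k_strong_parity_def
proof (intro allI impI)
  fix X assume X: "X \<subseteq> verts G" "even (card X)"
  have finV: "finite (verts G)" using G by (simp add: simple_graph_def)
  define b where "b v = (if v \<in> X then degree G v - 1 else degree G v - k)" for v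
  \<comment> \<open>The degree sum exceeds \<open>sum b (verts G)\<close> by \<open>card X\<close>
    plus a multiple of \<open>k\<close>, which is even.\<close>
  have "(\<Sum>v\<in>verts G. degree G v) = (\<Sum>v\<in>verts G. b v + (if v \<in> X then 1 else k))"
    using deg \<open>0 < k\<close> by (intro sum.cong refl) (fastforce simp: b_def)
  also have "\<dots> = sum b (verts G) + (card (verts G \<inter> X) + k * card (verts G - X))"
    using finV by (simp add: sum.distrib sum.If_cases Diff_eq)
  finally have "2 * graph_size G = sum b (verts G) + (card X + k * card (verts G - X))"
    using handshake(2)[OF G] X(1) by (simp add: Int_absorb1)
  then have "even (sum b (verts G) + (card X + k * card (verts G - X)))"
    by (metis dvd_triv_left)
  then have "even (sum b (verts G))" using X(2) \<open>even k\<close> by simp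
  moreover have "card (\<kappa> ` (verts G - T)) \<le> sum b T + 1"
    if "T \<subseteq> verts G"
      "\<And>x y. x \<in> verts G - T \<Longrightarrow> y \<in> verts G - T \<Longrightarrow> {x, y} \<in> edges G \<Longrightarrow> \<kappa> x = \<kappa> y"
    for T and \<kappa> :: "'a \<Rightarrow> nat"
  proof -
    have "(\<Sum>v\<in>T. degree G v - k) \<le> sum b T"
      using \<open>0 < k\<close> by (intro sum_mono) (auto simp: b_def)
    then show ?thesis using cond[of T \<kappa>] that by fastforce
  qed
  ultimately obtain H where H: "H \<subseteq> edges G"
    "\<And>v. v \<in> verts G \<Longrightarrow> card {e \<in> H. v \<in> e} \<le> b v"
    "\<And>v. v \<in> verts G \<Longrightarrow> even (card {e \<in> H. v \<in> e}) \<longleftrightarrow> even (b v)"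
    using bounded_parity_subgraph[OF G, of b] by blast
  define F where "F = \<lparr>verts = verts G, edges = edges G - H\<rparr>"
  have degF: "degree F v = degree G v - card {e \<in> H. v \<in> e}" for v
  proof -
    have "{e \<in> edges F. v \<in> e} = {e \<in> edges G. v \<in> e} - {e \<in> H. v \<in> e}"
      by (auto simp: F_def)
    moreover have "finite H" using H(1) handshake(1)[OF G] finite_subset by blast
    ultimately show ?thesis
      using H(1) unfolding degree_def by (auto intro!: card_Diff_subset)
  qed
  have "spanning_subgraph F G"
    using G by (auto simp: spanning_subgraph_def simple_graph_def F_def)
  moreover have "odd (degree F v)" if "v \<in> X" for v
  proof -
    have v: "v \<in> verts G" using that X(1) by blast
    then have "b v + 1 = degree G v" using deg[OF v] \<open>0 < k\<close> that by (simp add: b_def)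
    then have "degree F v = b v - card {e \<in> H. v \<in> e} + 1" using degF H(2)[OF v] by simp
    then show ?thesis using H(2,3)[OF v] by simp
  qed
  moreover have "degree F v \<in> {k + 2 * i | i. True}" if "v \<in> verts G - X" for v
  proof -
    have v: "v \<in> verts G" using that by blast
    then have "b v + k = degree G v" using deg[OF v] that by (simp add: b_def)
    then have "degree F v = k + (b v - card {e \<in> H. v \<in> e})" using degF H(2)[OF v] by simp
    moreover have "even (b v - card {e \<in> H. v \<in> e})" using H(2,3)[OF v] by simp
    then obtain i where "b v - card {e \<in> H. v \<in> e} = 2 * i" by (rule evenE)
    ultimately show ?thesis by auto
  qed
  ultimately show "\<exists>F. spanning_subgraph F G \<and> (\<forall>u\<in>X. odd (degree F u)) \<and>
      (\<forall>v\<in>verts G - X. degree F v \<in> {k + 2 * i |i. True})"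
    by blast
qed

section \<open>Counting edges\<close>

lemma choose_two_add:
  fixes m n :: nat
  shows "(m + n) choose 2 = (m choose 2) + (n choose 2) + m * n"
proof (induction m)
  case (Suc m)
  have "Suc j choose 2 = j + (j choose 2)" for j :: nat
    unfolding numeral_2_eq_2 by simp
  then show ?case using Suc by simp
qed simp

lemma double_choose_two: "2 * (n choose 2) = n * (n - 1)" for n :: nat
proof -
  have "even (n * (n - 1))" by (cases "even n") auto
  then show ?thesis unfolding choose_two by (rule dvd_mult_div_cancel)
qed

text \<open>By convexity the sum is largest when all parts but one have the least size
  \<open>a\<close>; \<open>y\<close> is then the size of the exceptional part. The induction moves
  the excess of one part over \<open>a\<close> to another.\<close>

lemma sum_choose_two_le:
  fixes s :: "'i \<Rightarrow> nat"
  assumes "finite I" "card I = Suc m" "\<And>i. i \<in> I \<Longrightarrow> a \<le> s i" "sum s I = y + m * a"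
  shows "(\<Sum>i\<in>I. s i choose 2) \<le> (y choose 2) + m * (a choose 2)"
  using assms
proof (induction m arbitrary: I y)
  case 0
  then obtain i where "I = {i}" by (metis One_nat_def card_1_singletonE)
  then show ?case using 0 by simp
next
  case (Suc m)
  then obtain i J where I: "I = insert i J" "i \<notin> J" "card J = Suc m"
    by (metis card_Suc_eq)
  then have J: "finite J" using Suc.prems(1) by simp
  have "Suc m * a \<le> sum s J"
    using sum_bounded_below[of J a s] Suc.prems(3) I by simp
  then obtain q where q: "sum s J = (a + q) + m * a"
    using le_Suc_ex by (metis add.assoc add.commute mult_Suc)
  obtain p where p: "s i = a + p" using Suc.prems(3)[of i] I le_Suc_ex by blast
  have y: "y = a + p + q" using Suc.prems(4) I J p q by simp
  have "(\<Sum>j\<in>J. s j choose 2) \<le> ((a + q) choose 2) + m * (a choose 2)"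
    using Suc.IH[of J "a + q"] I J q Suc.prems(3) by simp
  \<comment> \<open>The sides differ by \<open>p * q\<close>.\<close>
  moreover have "((a + p) choose 2) + ((a + q) choose 2) \<le> ((a + p + q) choose 2) + (a choose 2)"
    by (simp add: choose_two_add algebra_simps)
  ultimately show ?case using I J p y by simp
qed

section \<open>Sizes of joins, unions and the extremal graph\<close>

lemma graph_size_join:
  fixes G :: "'a graph" and H :: "'b graph"
  assumes "simple_graph G" "simple_graph H"
  shows "graph_size (graph_join G H)
    = graph_size G + graph_size H + graph_order G * graph_order H"
proof -
  let ?A = "(\<lambda>e. Inl ` e) ` edges G :: ('a + 'b) set set"
    and ?B = "(\<lambda>e. Inr ` e) ` edges H :: ('a + 'b) set set"
  let ?C = "{{Inl u, Inr v} | u v. u \<in> verts G \<and> v \<in> verts H} :: ('a + 'b) set set"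
  have fin: "finite (edges G)" "finite (edges H)" "finite (verts G)" "finite (verts H)"
    using assms handshake(1) by (auto simp: simple_graph_def)
  have C: "?C = (\<lambda>(u, v). {Inl u, Inr v}) ` (verts G \<times> verts H)" by auto
  \<comment> \<open>An empty edge would have the same image under \<open>Inl\<close> and
    \<open>Inr\<close>.\<close>
  have ne: "e \<noteq> {}" if "e \<in> edges G" for e using assms that by (auto simp: simple_graph_def)
  have "?A \<inter> ?B = {}" using ne by auto
  moreover have "(?A \<union> ?B) \<inter> ?C = {}" by auto
  moreover have "card ?A = graph_size G" "card ?B = graph_size H"
    unfolding graph_size_def by (auto intro!: card_image inj_onI simp: inj_image_eq_iff)
  moreover have "card ?C = graph_order G * graph_order H"
    unfolding C graph_order_def
    by (subst card_image) (auto simp: inj_on_def doubleton_eq_iff card_cartesian_product)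
  ultimately show ?thesis
    using fin by (simp add: graph_size_def graph_join_def graph_union_def card_Un_disjoint C)
qed

lemma graph_size_union:
  fixes G :: "'a graph" and H :: "'b graph"
  assumes "simple_graph G" "simple_graph H"
  shows "graph_size (graph_union G H) = graph_size G + graph_size H"
proof -
  let ?A = "(\<lambda>e. Inl ` e) ` edges G :: ('a + 'b) set set"
    and ?B = "(\<lambda>e. Inr ` e) ` edges H :: ('a + 'b) set set"
  have fin: "finite (edges G)" "finite (edges H)" using assms handshake(1) by auto
  have ne: "e \<noteq> {}" if "e \<in> edges G" for e using assms that by (auto simp: simple_graph_def)
  have "?A \<inter> ?B = {}" using ne by auto
  moreover have "card ?A = graph_size G" "card ?B = graph_size H"
    unfolding graph_size_def by (auto intro!: card_image inj_onI simp: inj_image_eq_iff)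
  ultimately show ?thesis
    using fin by (simp add: graph_size_def graph_union_def card_Un_disjoint)
qed

lemma simple_graph_union:
  assumes "simple_graph G" "simple_graph H"
  shows "simple_graph (graph_union G H)"
proof -
  have "e \<subseteq> verts G <+> verts H \<and> card e = 2" if e: "e \<in> edges (graph_union G H)" for e
  proof -
    consider e' where "e = Inl ` e'" "e' \<in> edges G" | e' where "e = Inr ` e'" "e' \<in> edges H"
      using e unfolding graph_union_def by auto
    then show ?thesis
      by cases (use assms in \<open>auto simp: simple_graph_def card_image\<close>)
  qed
  then show ?thesis using assms by (simp add: simple_graph_def graph_union_def)
qed

lemma simple_graph_complete: "simple_graph (complete_graph m)"
  by (simp add: simple_graph_def complete_graph_def)

lemma simple_graph_edgeless: "simple_graph (edgeless_graph m)"
  by (simp add: simple_graph_def edgeless_graph_def)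

lemma graph_size_extremal:
  assumes "q = n - (d - k + 1) * d - 1"
  shows "graph_size (extremal_graph k d n)
    = (d choose 2) + (q choose 2) + d * (q + ((d - k) * d + 1))"
proof -
  have "graph_size (complete_graph m) = m choose 2" for m
    using n_subsets[of "{..<m}" 2] by (simp add: graph_size_def complete_graph_def)
  moreover have "graph_order (complete_graph m) = m" for m
    by (simp add: graph_order_def complete_graph_def)
  moreover have "graph_size (edgeless_graph m) = 0" for m
    by (simp add: graph_size_def edgeless_graph_def)
  moreover have "graph_order (graph_union (complete_graph m) (edgeless_graph m')) = m + m'" for m m'
    by (simp add: graph_order_def graph_union_def complete_graph_def edgeless_graph_def card_Plus)
  ultimately show ?thesis
    unfolding extremal_graph_def assms
    by (simp add: graph_size_join graph_size_union simple_graph_union simple_graph_complete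
        simple_graph_edgeless)
qed

section \<open>Disconnecting sets force a smaller size\<close>

text \<open>Arithmetic for a set of \<open>t\<close> vertices with degree sum \<open>D\<close> whose
  removal leaves \<open>m\<close> classes of the least order \<open>a\<close> and one of order
  \<open>y\<close>. The edges not inside the latter number fewer than \<open>d\<close> per vertex
  outside it; the extremal graph makes up for these through its clique of order \<open>q\<close> and
  the \<open>d\<close> vertices joined to it.\<close>

lemma disconnecting_size_less:
  fixes k d n t m a y D q :: nat
  assumes "k + 1 \<le> d" "1 \<le> t" and D: "D + 1 \<le> m + k * t" and m: "(d - k) * t + 1 \<le> m"
    and a: "a = max 1 (d + 1 - t)" and n: "n = t + y + m * a"
    and n_large: "d^2 + 4 * d + 6 \<le> n + k^2" and q: "q = n - (d - k + 1) * d - 1"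
  shows "D + ((y choose 2) + m * (a choose 2))
    < (d choose 2) + (q choose 2) + d * (q + ((d - k) * d + 1))"
proof -
  obtain r where r: "d = k + r" "1 \<le> r" using \<open>k + 1 \<le> d\<close> by (metis add.assoc add.commute le_add1 le_iff_add)
  have dk: "d - k = r" using r by simp
  \<comment> \<open>The extremal graph has \<open>(r + 1) * d + 1\<close> vertices outside its large
    clique. At least as many lie outside the class of order \<open>y\<close>, which gives
    \<open>y \<le> q\<close>.\<close>
  have outside: "(r + 1) * d + 1 \<le> m * a + t"
  proof (cases "d \<le> t")
    case True
    then have "a = 1" using a by simp
    moreover have "(r + 1) * d \<le> (r + 1) * t" using True by (rule mult_le_mono2)
    ultimately show ?thesis using m dk by simp
  next
    case False
    then obtain u where u: "d = t + u" "1 \<le> u" by (metis less_imp_add_positive not_le Suc_leI One_nat_def)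
    then have au: "a = u + 1" using a by simp
    obtain t' where t': "t = t' + 1" using \<open>1 \<le> t\<close> by (metis add.commute le_Suc_ex)
    \<comment> \<open>The sides differ by \<open>r * u * t'\<close>.\<close>
    have "(r + 1) * d + 1 \<le> (r * t + 1) * (u + 1) + t"
      unfolding u(1) t' by (simp add: algebra_simps)
    also have "(r * t + 1) * (u + 1) \<le> m * a" unfolding au using m dk by (intro mult_le_mono1) simp
    finally show ?thesis by simp
  qed
  then have "n = q + (r + 1) * d + 1"
    using n q unfolding dk by linarith
  moreover from this outside have "y \<le> q"
    using n by linarith
  ultimately obtain p where p: "q = y + p" "n = q + (r + 1) * d + 1"
    using le_Suc_ex by blast
  \<comment> \<open>The quadratic part of the bound on \<open>n\<close> cancels against the vertices
    outside the clique and leaves a bound on \<open>q\<close> linear in \<open>d\<close>.\<close>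
  have "d^2 = k^2 + r * k + r * d" using r(1) by (simp add: power2_eq_square algebra_simps)
  then have q_large: "3 * d + 5 \<le> y + p" using n_large p by (simp add: algebra_simps)
  \<comment> \<open>The \<open>1\<close> is the share of one class in the bound on \<open>D\<close>;
    the binomial counts its inner edges.\<close>
  have "1 + (a choose 2) \<le> a * d"
  proof -
    have "a \<le> d" "1 \<le> a" using a \<open>1 \<le> t\<close> r by auto
    have "2 * (a choose 2) = a * (a - 1)" by (simp only: double_choose_two)
    also have "\<dots> + a = a * a" using \<open>1 \<le> a\<close> by (simp add: algebra_simps)
    also have "\<dots> \<le> a * d" using \<open>a \<le> d\<close> by simp
    finally have "2 * (a choose 2) + a \<le> a * d" .
    then show ?thesis using \<open>1 \<le> a\<close> by (cases "a = 1") (use r in auto)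
  qed
  then have "m * (1 + (a choose 2)) \<le> m * (a * d)" by (rule mult_le_mono2)
  moreover have "k * t \<le> d * t" using r by simp
  moreover have "m * (1 + (a choose 2)) = m + m * (a choose 2)"
    "d * (m * a + t) = m * (a * d) + d * t" by (simp_all add: algebra_simps)
  ultimately have "D + m * (a choose 2) < d * (m * a + t)" using D by linarith
  also have "m * a + t = p + (r + 1) * d + 1" using n p by simp
  finally have "D + m * (a choose 2) < d * (p + (r + 1) * d + 1)" .
  \<comment> \<open>This covers the excess \<open>d * d\<close> of the last bound. If
    \<open>d \<le> y\<close>, the term \<open>d * y\<close> suffices; otherwise \<open>p\<close>
    exceeds \<open>2 * d\<close>.\<close>
  moreover have "d * d \<le> (p choose 2) + y * p + d * y"
  proof (cases "d \<le> y")
    case False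
    then have "2 * d + 1 \<le> p" using q_large by simp
    then have "(2 * d + 1) * (2 * d) \<le> p * (p - 1)" by (intro mult_le_mono) auto
    also have "\<dots> = 2 * (p choose 2)" by (simp only: double_choose_two)
    finally show ?thesis by (simp add: algebra_simps)
  qed (simp add: trans_le_add2)
  ultimately show ?thesis unfolding dk p(1) by (simp add: choose_two_add algebra_simps)
qed

text \<open>An edge meets \<open>T\<close> or lies inside a label class. The former are at most the
  degree sum of \<open>T\<close>, which \<open>many\<close> bounds through the number of classes;
  the latter are bounded by convexity.\<close>

lemma disconnecting_graph_size_less:
  fixes G :: "'a graph" and \<kappa> :: "'a \<Rightarrow> nat"
  assumes G: "simple_graph G" and n: "graph_order G = n" and "k + 1 \<le> d"
    and deg: "\<And>v. v \<in> verts G \<Longrightarrow> d \<le> degree G v"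
    and n_large: "d^2 + 4 * d + 6 \<le> n + k^2"
    and T: "T \<subseteq> verts G" "T \<noteq> {}"
    and \<kappa>: "\<And>x y. x \<in> verts G - T \<Longrightarrow> y \<in> verts G - T \<Longrightarrow> {x, y} \<in> edges G \<Longrightarrow> \<kappa> x = \<kappa> y"
    and many: "(\<Sum>v\<in>T. degree G v - k) + 2 \<le> card (\<kappa> ` (verts G - T))"
  shows "graph_size G < graph_size (extremal_graph k d n)"
proof -
  define V where "V = verts G"
  define L where "L = \<kappa> ` (V - T)"
  define C where "C l = {x\<in>V - T. \<kappa> x = l}" for l
  have finV: "finite V" and edge: "\<And>e. e \<in> edges G \<Longrightarrow> e \<subseteq> V \<and> card e = 2"
    using G by (auto simp: simple_graph_def V_def)
  have finT: "finite T" using T(1) finV V_def finite_subset by blast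
  have finL: "finite L" and finC: "finite (C l)" for l using finV by (simp_all add: L_def C_def)
  obtain m where m: "card L = Suc m" using many by (metis L_def V_def add_2_eq_Suc' Suc_le_D)
  \<comment> \<open>Neighbours of a vertex lie in its class or in \<open>T\<close>, so a class has
    at least \<open>d + 1 - card T\<close> vertices. For large \<open>T\<close> only nonemptiness
    remains.\<close>
  define a where "a = max 1 (d + 1 - card T)"
  have a: "a \<le> card (C l)" if l: "l \<in> L" for l
  proof -
    obtain x where x: "x \<in> C l" using l by (auto simp: L_def C_def)
    have "degree G x = card {u. {x, u} \<in> edges G}"
      unfolding degree_def using edge by (intro card_incident_edges) auto
    also have "\<dots> \<le> card ((C l - {x}) \<union> T)"
    proof (rule card_mono)
      show "{u. {x, u} \<in> edges G} \<subseteq> (C l - {x}) \<union> T"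
      proof
        fix u assume "u \<in> {u. {x, u} \<in> edges G}"
        then have xu: "{x, u} \<in> edges G" by simp
        then have "u \<in> V" "u \<noteq> x" using edge[OF xu] by auto
        moreover have "\<kappa> u = l" if "u \<notin> T"
          using \<kappa>[OF _ _ xu] x that \<open>u \<in> V\<close> by (simp add: C_def V_def)
        ultimately show "u \<in> (C l - {x}) \<union> T" by (auto simp: C_def)
      qed
    qed (use finC finT in auto)
    also have "\<dots> \<le> card (C l - {x}) + card T" by (rule card_Un_le)
    also have "card (C l - {x}) = card (C l) - 1" using x by simp
    finally have "d \<le> card (C l) - 1 + card T"
      using deg[of x] x by (auto simp: C_def V_def)
    moreover have "1 \<le> card (C l)" using x finC by (auto simp: Suc_le_eq card_gt_0_iff)
    ultimately show ?thesis by (simp add: a_def)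
  qed
  have sumC: "(\<Sum>l\<in>L. card (C l)) = card (V - T)"
    using sum.image_gen[of "V - T" "\<lambda>_. 1::nat" \<kappa>] finV by (simp add: L_def C_def)
  have "Suc m * a \<le> card (V - T)"
    using sum_bounded_below[of L a "\<lambda>l. card (C l)"] a m sumC by simp
  \<comment> \<open>\<open>y\<close> is the order one class would have if the \<open>m\<close>
    others had exactly \<open>a\<close> vertices.\<close>
  then obtain y where y: "card (V - T) = y + m * a"
    by (metis add.commute le_Suc_ex mult_Suc add_leD2)
  have "edges G \<subseteq> (\<Union>v\<in>T. {e\<in>edges G. v \<in> e}) \<union> (\<Union>l\<in>L. {e. e \<subseteq> C l \<and> card e = 2})"
  proof
    fix e assume e: "e \<in> edges G"
    then obtain u v where uv: "e = {u, v}" using edge[OF e] by (auto simp: card_2_iff)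
    show "e \<in> (\<Union>v\<in>T. {e\<in>edges G. v \<in> e}) \<union> (\<Union>l\<in>L. {e. e \<subseteq> C l \<and> card e = 2})"
    proof (cases "e \<inter> T = {}")
      case True
      then have "u \<in> V - T" "v \<in> V - T" using edge[OF e] uv by auto
      moreover from this have "\<kappa> u = \<kappa> v" using \<kappa>[of u v] e uv V_def by blast
      ultimately have "\<kappa> u \<in> L" "e \<subseteq> C (\<kappa> u)" using uv by (auto simp: L_def C_def)
      then show ?thesis using edge[OF e] by blast
    qed (use e in blast)
  qed
  then have "graph_size G \<le> card ((\<Union>v\<in>T. {e\<in>edges G. v \<in> e}) \<union> (\<Union>l\<in>L. {e. e \<subseteq> C l \<and> card e = 2}))"
    unfolding graph_size_def using finL finC finT handshake(1)[OF G] by (intro card_mono) auto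
  also have "\<dots> \<le> card (\<Union>v\<in>T. {e\<in>edges G. v \<in> e}) + card (\<Union>l\<in>L. {e. e \<subseteq> C l \<and> card e = 2})"
    by (rule card_Un_le)
  also have "card (\<Union>v\<in>T. {e\<in>edges G. v \<in> e}) \<le> (\<Sum>v\<in>T. degree G v)"
    unfolding degree_def using finT by (rule card_UN_le)
  also have "card (\<Union>l\<in>L. {e. e \<subseteq> C l \<and> card e = 2}) \<le> (\<Sum>l\<in>L. card (C l) choose 2)"
    using card_UN_le[OF finL, of "\<lambda>l. {e. e \<subseteq> C l \<and> card e = 2}"] finC by (simp add: n_subsets)
  also have "\<dots> \<le> (y choose 2) + m * (a choose 2)"
    using finL m a sumC y by (intro sum_choose_two_le) auto
  finally have "graph_size G \<le> (\<Sum>v\<in>T. degree G v) + ((y choose 2) + m * (a choose 2))" by simp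
  also have "\<dots> < graph_size (extremal_graph k d n)"
    unfolding graph_size_extremal[OF refl]
  proof (rule disconnecting_size_less[OF \<open>k + 1 \<le> d\<close> _ _ _ a_def _ n_large refl])
    show "1 \<le> card T" using T(2) finT by (simp add: Suc_le_eq card_gt_0_iff)
    have "(\<Sum>v\<in>T. degree G v) = (\<Sum>v\<in>T. (degree G v - k) + k)"
      using deg T(1) \<open>k + 1 \<le> d\<close> by (intro sum.cong refl) fastforce
    then have "(\<Sum>v\<in>T. degree G v) = (\<Sum>v\<in>T. degree G v - k) + k * card T"
      by (simp add: sum.distrib)
    \<comment> \<open>Of the \<open>2\<close> in \<open>many\<close>, one is used up by
      \<open>card L = Suc m\<close>; the other is the \<open>1\<close> here and in the bound on
      \<open>m\<close> below.\<close>
    then show "(\<Sum>v\<in>T. degree G v) + 1 \<le> m + k * card T"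
      using many m by (simp add: L_def V_def)
    have "(\<Sum>v\<in>T. d - k) \<le> (\<Sum>v\<in>T. degree G v - k)"
      using deg T(1) by (intro sum_mono diff_le_mono) auto
    then show "(d - k) * card T + 1 \<le> m"
      using many m by (simp add: L_def V_def mult.commute)
    have "card V = card T + card (V - T)"
      using card_Int_Diff[OF finV, of T] T(1) by (simp add: V_def Int_absorb1)
    then show "n = card T + y + m * a" using n y by (simp add: graph_order_def V_def)
  qed
  finally show ?thesis .
qed

section \<open>Connected graphs and the size threshold\<close>

lemma connected_graph_constant:
  assumes "simple_graph G" "connected_graph G"
    and "\<And>x y. x \<in> verts G \<Longrightarrow> y \<in> verts G \<Longrightarrow> {x, y} \<in> edges G \<Longrightarrow> \<kappa> x = \<kappa> y"
    and "u \<in> verts G" "v \<in> verts G"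
  shows "\<kappa> u = \<kappa> v"
proof -
  have "(u, v) \<in> {(x, y). {x, y} \<in> edges G}\<^sup>*"
    using assms by (simp add: connected_graph_def)
  then show ?thesis
  proof (induction rule: rtrancl_induct)
    case (step x y)
    then have "x \<in> verts G" "y \<in> verts G" using assms(1) by (auto simp: simple_graph_def)
    then show ?case using assms(3) step by auto
  qed simp
qed

theorem theorem1p2:
  fixes G :: "'a graph" and k \<delta> n :: nat
  assumes "k \<ge> 2" and "even k"
    and "simple_graph G" and "connected_graph G"
    and "\<delta> = min_degree G" and "n = graph_order G"
    and "\<delta> \<ge> k + 1"
    and "real n \<ge> max
           (((real \<delta>)^2 + (2 - real k) * real \<delta> - 2 * real k - 1)^2 / (6 * (real \<delta> - real k))
              + real \<delta> + real k + 1)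
           ((real \<delta>)^2 + 4 * real \<delta> - (real k)^2 + 6)"
    and "graph_size G \<ge> graph_size (extremal_graph k \<delta> n)"
  shows "\<not> graph_iso G (extremal_graph k \<delta> n) \<longrightarrow> k_strong_parity k G"
proof
  have deg: "\<delta> \<le> degree G v" if "v \<in> verts G" for v
    using assms(3,5) that by (simp add: min_degree_def simple_graph_def)
  \<comment> \<open>The second bound under the maximum, with \<open>k^2\<close> moved across so that
    no truncated subtraction arises.\<close>
  have "real (\<delta>^2 + 4 * \<delta> + 6) \<le> real (n + k^2)" using assms(8) by simp
  then have n_large: "\<delta>^2 + 4 * \<delta> + 6 \<le> n + k^2" by linarith
  show "k_strong_parity k G"
  proof (rule k_strong_parityI)
    show "k \<le> degree G v" if "v \<in> verts G" for v using deg[OF that] assms(7) by simp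
    fix T and \<kappa> :: "'a \<Rightarrow> nat"
    assume T: "T \<subseteq> verts G"
      and \<kappa>: "\<And>x y. x \<in> verts G - T \<Longrightarrow> y \<in> verts G - T \<Longrightarrow> {x, y} \<in> edges G \<Longrightarrow> \<kappa> x = \<kappa> y"
    show "card (\<kappa> ` (verts G - T)) \<le> (\<Sum>v\<in>T. degree G v - k) + 1"
    proof (cases "T = {}")
      \<comment> \<open>The sum vanishes, and the \<open>+ 1\<close> admits the single class of a
        connected graph.\<close>
      case True
      obtain u where u: "u \<in> verts G"
        using assms(4) by (auto simp: connected_graph_def)
      have "\<kappa> x = \<kappa> u" if "x \<in> verts G" for x
        using connected_graph_constant[OF assms(3,4) _ that u, of \<kappa>] \<kappa> True by simp
      then have "\<kappa> ` verts G = {\<kappa> u}" using u by blast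
      then show ?thesis using True by simp
    next
      case False
      show ?thesis
      proof (rule ccontr)
        assume "\<not> ?thesis"
        then have many: "(\<Sum>v\<in>T. degree G v - k) + 2 \<le> card (\<kappa> ` (verts G - T))"
          by linarith
        have "graph_size G < graph_size (extremal_graph k \<delta> n)"
          by (rule disconnecting_graph_size_less
              [OF assms(3) assms(6)[symmetric] assms(7) deg n_large T False \<kappa> many])
        then show False using assms(9) by simp
      qed
    qed
  qed (use assms in auto)
qed

end
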